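(* Let $\lambda>0$ and $1/3<\alpha<1$ be such that $\lambda<(2-\sqrt3)(3\alpha-1)$. Then $G_{\lambda,\alpha}\subset\Omega$.
   Context: $\mathbb{D}=\{z\in\mathbb{C}:|z|<1\}$. $\mathcal{A}$ is the class of analytic functions $f$ on $\mathbb{D}$ with $f(0)=0$, $f'(0)=1$. For $0<\alpha\le1$ and $\lambda>0$, $$G_{\lambda,\alpha}=\left\{f\in\mathcal{A}:\left|\frac{1-\alpha+\alpha zf''(z)/f'(z)}{zf'(z)/f(z)}-(1-\alpha)\right|<\lambda,\ z\in\mathbb{D}\right\},$$ where expressions such as $zf'(z)/f(z)$ are given their limiting values at $z=0$. Also $$\Omega=\left\{f\in\mathcal{A}:|zf'(z)-f(z)|<\tfrac12,\ z\in\mathbb{D}\right\}.$$ *)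

theory Defs
  imports "HOL-Complex_Analysis.Complex_Analysis"
begin

text \<open>Functions on the open unit disc are total functions on \<^typ>\<open>complex\<close>; every condition below
  depends only on their values on the disc.\<close>

definition class_A :: "(complex \<Rightarrow> complex) set" where
  "class_A = {f. f holomorphic_on ball 0 1 \<and> f 0 = 0 \<and> deriv f 0 = 1}"

definition G_expr :: "real \<Rightarrow> (complex \<Rightarrow> complex) \<Rightarrow> complex \<Rightarrow> complex" where
  "G_expr \<alpha> f z =
     (1 - of_real \<alpha> + of_real \<alpha> * (z * deriv (deriv f) z / deriv f z)) / (z * deriv f z / f z)
       - (1 - of_real \<alpha>)"

text \<open>The expression is meromorphic on the disc, and its value at a point is taken as the limit
  there. Where the formula makes literal sense (\<^term>\<open>z\<close>, \<^term>\<open>f z\<close> and \<^term>\<open>deriv f z\<close> nonzero) this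
  is its ordinary value; at 0 and at any other removable singularity it is the limiting value
  (rather than an artefact of division by zero); at a pole there is no limit, so \<^term>\<open>f\<close> is excluded.\<close>

definition G_class :: "real \<Rightarrow> real \<Rightarrow> (complex \<Rightarrow> complex) set" where
  "G_class lam \<alpha> =
     {f \<in> class_A. \<forall>z \<in> ball 0 1. \<exists>v. (G_expr \<alpha> f \<longlongrightarrow> v) (at z) \<and> norm v < lam}"

definition Omega_class :: "(complex \<Rightarrow> complex) set" where
  "Omega_class = {f \<in> class_A. \<forall>z \<in> ball 0 1. norm (z * deriv f z - f z) < 1 / 2}"

end

theory Submission
  imports Defs
begin

text \<open>With \<open>q = f / (z f')\<close> the expression defining the class is
  \<open>(1 - 2\<alpha>)(q - 1) - \<alpha> z q'\<close>. Writing \<open>q = 1 + z W\<close> and the expression as \<open>z k\<close>, with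
  \<open>\<bar>k\<bar> \<le> \<lambda>\<close> by the Schwarz lemma, this becomes \<open>\<alpha> z W' + (3\<alpha> - 1) W = - k\<close>, whence
  \<open>\<bar>W\<bar> \<le> \<mu> = \<lambda> / (3\<alpha> - 1)\<close>. For \<open>u = f / z\<close> the identity \<open>u = f' (1 + z W)\<close> reads
  \<open>u' / u = - W / (1 + z W)\<close>, so \<open>\<bar>u\<bar> \<le> 1 / (1 - \<mu>\<bar>z\<bar>)\<close> and
  \<open>\<bar>z f' - f\<bar> = \<bar>z\<^sup>2 u'\<bar> \<le> \<mu>\<bar>z\<bar>\<^sup>2 / (1 - \<mu>\<bar>z\<bar>)\<^sup>2\<close>, which is below \<open>1/2\<close> as soon as
  \<open>\<mu> < 2 - sqrt 3\<close>.

  A priori \<open>q\<close> may have poles at zeros of \<open>f'\<close>. To avoid analysing them, \<open>W\<close> is constructed on the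
  whole disc as the power series solution of its differential equation, identified with
  \<open>(q - 1) / z\<close> near 0, and \<open>u = f' (1 + z W)\<close> then extends by analytic continuation.\<close>

section \<open>The radial equation \<open>a z W' + b W = g\<close>: bound and solvability\<close>

lemma scaled_in_ball:
  fixes z :: complex
  assumes "0 \<le> t" "t \<le> 1" "z \<in> ball 0 R"
  shows "of_real t * z \<in> ball 0 R"
proof -
  have "t * norm z \<le> 1 * norm z" using assms by (intro mult_right_mono) auto
  then have "t * norm z < R" using assms(3) by simp
  then show ?thesis using assms(1) by (simp add: norm_mult)
qed

text \<open>The bound on \<^term>\<open>a * z * deriv W z + b * W z\<close> controls the derivative of
  \<open>t \<mapsto> t\<^bsup>b/a\<^esup> W(tz)\<close> on the unit interval; at \<open>t = 0\<close> this function vanishes.\<close>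

lemma radial_ode_bound:
  fixes W :: "complex \<Rightarrow> complex"
  assumes hol: "W holomorphic_on ball 0 R"
    and a: "0 < a" and b: "0 < b"
    and bnd: "\<And>z. z \<in> ball 0 R - {0} \<Longrightarrow>
      norm (of_real a * z * deriv W z + of_real b * W z) \<le> M"
    and z: "z \<in> ball 0 R - {0}"
  shows "norm (W z) \<le> M / b"
proof -
  define c where "c = b / a"
  have bc: "b = a * c" using a by (simp add: c_def)
  have c: "c > 0" using a b by (simp add: c_def)
  define \<phi> where "\<phi> t = of_real (t powr c) * W (of_real t * z)" for t :: real
  \<comment> \<open>The majorant: its derivative is \<open>M / a * t powr (c - 1)\<close>, exactly
    the bound obtained for the derivative of \<open>\<phi>\<close>, and its increment over the unit
    interval is \<open>M / b\<close>.\<close>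
  define \<psi> where "\<psi> t = M / b * t powr c" for t :: real
  have zR: "z \<in> ball 0 R" using z by simp
  note in_ball = scaled_in_ball[OF _ _ zR]
  have cW: "continuous_on {0..1} (\<lambda>t. W (of_real t * z))"
    by (rule continuous_on_compose2[OF holomorphic_on_imp_continuous_on[OF hol]])
      (use in_ball in \<open>auto intro!: continuous_intros\<close>)
  have cp: "continuous_on {0..1} (\<lambda>t::real. t powr c)"
    by (intro continuous_on_powr' continuous_intros) (use c in auto)
  have "norm (\<phi> 1 - \<phi> 0) \<le> \<psi> 1 - \<psi> 0"
  \<comment> \<open>Derivatives are needed only for \<open>0 < t < 1\<close>. At 0 continuity
    suffices, which matters because \<open>t powr c\<close> is not differentiable there when
    \<open>c < 1\<close>.\<close>
  proof (rule differentiable_bound_general)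
    show "continuous_on {0..1} \<phi>"
      unfolding \<phi>_def by (intro continuous_intros cW cp)
    show "continuous_on {0..1} \<psi>"
      unfolding \<psi>_def by (intro continuous_intros cp)
    fix t :: real assume t: "0 < t" "t < 1"
    let ?w = "of_real t * z"
    have wb: "?w \<in> ball 0 R - {0}" using in_ball[of t] t z by auto
    have dW: "(W has_field_derivative deriv W ?w) (at ?w)"
      using hol wb by (auto intro: holomorphic_derivI)
    have dWt: "((\<lambda>t. W (of_real t * z)) has_vector_derivative z * deriv W ?w) (at t)"
    proof -
      have "((\<lambda>t. of_real t * z) has_vector_derivative z) (at t)"
        by (auto intro!: derivative_eq_intros simp: has_vector_derivative_def scaleR_conv_of_real)
      from field_vector_diff_chain_at[OF this dW] show ?thesis by (simp add: o_def)
    qed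
    have dp: "((\<lambda>t. t powr c) has_real_derivative c * t powr (c - 1)) (at t)"
      using t by (auto intro!: derivative_eq_intros)
    have dpc: "((\<lambda>t. of_real (t powr c) :: complex) has_vector_derivative
        of_real (c * t powr (c - 1))) (at t)"
      using dp by (intro has_vector_derivative_of_real)
        (simp_all add: has_real_derivative_iff_has_vector_derivative)
    have tp: "t powr c = t powr (c - 1) * t" using t
      by (simp add: powr_diff)
    show "(\<phi> has_vector_derivative
        of_real (t powr (c - 1) / a) * (of_real a * ?w * deriv W ?w + of_real b * W ?w)) (at t)"
      unfolding \<phi>_def
      by (rule has_vector_derivative_eq_rhs[OF has_vector_derivative_mult[OF dpc dWt]])
        (use a in \<open>simp add: tp bc field_simps\<close>)
    show "(\<psi> has_vector_derivative (t powr (c - 1) / a) * M) (at t)"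
      unfolding \<psi>_def has_real_derivative_iff_has_vector_derivative[symmetric]
      using a b by (intro DERIV_cong[OF DERIV_cmult[OF dp]]) (simp add: c_def)
    show "norm (of_real (t powr (c - 1) / a) * (of_real a * ?w * deriv W ?w + of_real b * W ?w))
        \<le> (t powr (c - 1) / a) * M"
      using bnd[OF wb] a unfolding norm_mult norm_of_real by (intro mult_mono) auto
  qed auto
  then show ?thesis by (simp add: \<phi>_def \<psi>_def)
qed

text \<open>The operator on the left multiplies the n-th Taylor coefficient by
  \<open>a n + b\<close>, so the equation is solved by dividing each coefficient of \<open>g\<close>
  by this number. These divisors are at least \<open>b > 0\<close>, hence the radius of convergence
  does not drop below 1.\<close>

lemma radial_ode_solution:
  fixes g :: "complex \<Rightarrow> complex"
  assumes hol: "g holomorphic_on ball 0 1" and a: "0 < a" and b: "0 < b"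
  obtains W where "W holomorphic_on ball 0 1"
    "\<And>z. z \<in> ball 0 1 \<Longrightarrow> of_real a * z * deriv W z + of_real b * W z = g z"
proof -
  define p where "p n = (deriv ^^ n) g 0 / fact n" for n
  define F where "F = Abs_fps (\<lambda>n. p n / of_real (a * real n + b))"
  have sums: "(\<lambda>n. p n * z ^ n) sums g z" if "z \<in> ball 0 1" for z
    using holomorphic_power_series[OF hol that] by (simp add: p_def)
  have radp: "conv_radius p \<ge> 1"
  proof (rule conv_radius_geI_ex)
    fix r :: real assume r: "0 < r" "ereal r < 1"
    then have "summable (\<lambda>n. p n * of_real r ^ n)"
      by (intro sums_summable[OF sums]) auto
    then show "\<exists>z. norm z = r \<and> summable (\<lambda>n. p n * z ^ n)"
      using r by (intro exI[of _ "of_real r"]) auto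
  qed
  have rad: "fps_conv_radius F \<ge> 1"
    unfolding fps_conv_radius_def
  proof (rule conv_radius_geI_ex)
    fix r :: real assume r: "0 < r" "ereal r < 1"
    have "summable (\<lambda>n. norm (p n * of_real r ^ n))"
      using r less_le_trans[OF r(2) radp] by (intro abs_summable_in_conv_radius) auto
    then have "summable (\<lambda>n. norm (p n * of_real r ^ n) * (1 / b))"
      by (rule summable_mult2)
    then have "summable (\<lambda>n. fps_nth F n * of_real r ^ n)"
    proof (rule summable_comparison_test')
      fix n
      have "b \<le> a * real n + b" using a by simp
      then have "norm (p n * of_real r ^ n) / (a * real n + b) \<le> norm (p n * of_real r ^ n) / b"
        using b by (intro divide_left_mono mult_pos_pos) auto
      moreover have "norm (fps_nth F n * of_real r ^ n)
          = norm (p n * of_real r ^ n) / (a * real n + b)"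
      proof -
        have "norm (complex_of_real (a * real n + b)) = a * real n + b"
          unfolding norm_of_real using a b by simp
        then show ?thesis by (simp only: F_def fps_nth_Abs_fps norm_divide norm_mult) simp
      qed
      ultimately show "norm (fps_nth F n * of_real r ^ n) \<le> norm (p n * of_real r ^ n) * (1 / b)"
        by simp
    qed
    then show "\<exists>z. norm z = r \<and> summable (\<lambda>n. fps_nth F n * z ^ n)"
      using r by (intro exI[of _ "of_real r"]) auto
  qed
  have F_eq: "fps_const (of_real a) * (fps_X * fps_deriv F) + fps_const (of_real b) * F = Abs_fps p"
  proof (rule fps_ext)
    fix n
    have "a * real n + b \<noteq> 0" using a b by (metis add_nonneg_pos less_imp_le less_irrefl
          mult_nonneg_nonneg of_nat_0_le_iff)
    then have nz: "complex_of_real (a * real n + b) \<noteq> 0" by (metis of_real_eq_0_iff)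
    have "fps_nth (fps_const (of_real a) * (fps_X * fps_deriv F) + fps_const (of_real b) * F) n
        = complex_of_real (a * real n + b) * fps_nth F n"
      by (cases n) (simp_all add: algebra_simps)
    also have "\<dots> = p n" using nz by (simp add: F_def del: of_real_add of_real_mult)
    finally show "fps_nth (fps_const (of_real a) * (fps_X * fps_deriv F)
        + fps_const (of_real b) * F) n = fps_nth (Abs_fps p) n" by simp
  qed
  show ?thesis
  proof (rule that[of "eval_fps F"])
    have "ball 0 1 \<subseteq> eball (0::complex) (fps_conv_radius F)"
      using less_le_trans[OF _ rad] by (simp add: subset_iff in_eball_iff)
    then show "eval_fps F holomorphic_on ball 0 1" by (rule holomorphic_on_eval_fps)
    fix z :: complex assume z: "z \<in> ball 0 1"
    \<comment> \<open>Evaluation respects sums, products and derivatives only inside the radii of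
      convergence, so each factor and partial product is checked in turn.\<close>
    have z1: "ereal (norm z) < fps_conv_radius F"
      using z rad by (auto intro: less_le_trans[of _ 1])
    have z2: "ereal (norm z) < fps_conv_radius (fps_deriv F)"
      using z1 fps_conv_radius_deriv[of F] by (rule less_le_trans)
    have z3: "ereal (norm z) < fps_conv_radius (fps_X * fps_deriv F)"
      using z2 by (intro less_le_trans[OF _ fps_conv_radius_mult]) auto
    have z4: "ereal (norm z) < fps_conv_radius (fps_const (of_real a) * (fps_X * fps_deriv F))"
      using z3 by (intro less_le_trans[OF _ fps_conv_radius_mult]) auto
    have z5: "ereal (norm z) < fps_conv_radius (fps_const (of_real b) * F)"
      using z1 by (intro less_le_trans[OF _ fps_conv_radius_mult]) auto
    have "eval_fps (fps_const (of_real a) * (fps_X * fps_deriv F) + fps_const (of_real b) * F) z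
        = of_real a * z * deriv (eval_fps F) z + of_real b * eval_fps F z"
      using z1 z2 z3 z4 z5
      by (simp add: eval_fps_add eval_fps_mult eval_fps_deriv)
    then show "of_real a * z * deriv (eval_fps F) z + of_real b * eval_fps F z = g z"
      using sums[OF z] by (simp add: F_eq eval_fps_def sums_iff)
  qed
qed

section \<open>Growth of a function with controlled logarithmic derivative\<close>

text \<open>With \<open>H\<close> the primitive of \<open>h\<close> vanishing at 0,
  \<open>u * exp (- H)\<close> has derivative zero, so \<open>u = exp H\<close>. Integrating the
  bound on \<open>h\<close> along the radius gives
  \<open>norm (H z) \<le> - ln (1 - \<mu> * norm z)\<close>, and
  \<open>norm (exp (H z)) \<le> exp (norm (H z))\<close> finishes.\<close>

lemma log_derivative_growth:
  fixes u h :: "complex \<Rightarrow> complex"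
  assumes holh: "h holomorphic_on ball 0 1"
    and du: "\<And>z. z \<in> ball 0 1 \<Longrightarrow> (u has_field_derivative h z * u z) (at z)"
    and u0: "u 0 = 1"
    and \<mu>: "0 \<le> \<mu>" "\<mu> < 1"
    and bnd: "\<And>z. z \<in> ball 0 1 - {0} \<Longrightarrow> norm (h z) \<le> \<mu> / (1 - \<mu> * norm z)"
    and z: "z \<in> ball 0 1"
  shows "norm (u z) \<le> 1 / (1 - \<mu> * norm z)"
proof (cases "z = 0")
  case True
  then show ?thesis by (simp add: u0)
next
  case False
  obtain H0 where H0: "\<And>z. z \<in> ball 0 1 \<Longrightarrow> (H0 has_field_derivative h z) (at z)"
    using holomorphic_convex_primitive'[OF convex_ball open_ball holh]
    by (metis at_within_open open_ball)
  define H where "H z = H0 z - H0 0" for z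
  have H: "(H has_field_derivative h z) (at z)" if "z \<in> ball 0 1" for z
    unfolding H_def using H0[OF that] by (auto intro!: derivative_eq_intros)
  have "\<exists>c. \<forall>w\<in>ball 0 1. u w * exp (- H w) = c"
  proof (rule has_field_derivative_zero_constant)
    fix w :: complex assume w: "w \<in> ball 0 1"
    show "((\<lambda>z. u z * exp (- H z)) has_field_derivative 0) (at w within ball 0 1)"
      by (rule has_field_derivative_at_within)
        (auto intro!: derivative_eq_intros du[OF w] H[OF w])
  qed auto
  then have "u z * exp (- H z) = u 0 * exp (- H 0)" using z by (metis centre_in_ball zero_less_one)
  then have "u z * exp (- H z) = 1" by (simp add: u0 H_def)
  then have "u z = exp (H z)" by (simp add: exp_minus field_simps)
  have pos: "0 < 1 - \<mu> * (t * norm z)" if "0 \<le> t" "t \<le> 1" for t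
  proof -
    have "t * norm z \<le> 1 * norm z" using that by (intro mult_right_mono) auto
    then have "t * norm z < 1" using z by simp
    then have "\<mu> * (t * norm z) \<le> \<mu> * 1" using \<mu> by (intro mult_left_mono) auto
    then show ?thesis using \<mu> by linarith
  qed
  note in_ball = scaled_in_ball[OF _ _ z]
  \<comment> \<open>The logarithm is the primitive in \<open>t\<close> of the bound on the
    derivative of \<open>H (t z)\<close>. The factors 1 and 0 display the endpoints of the
    path.\<close>
  have "norm (H (of_real 1 * z) - H (of_real 0 * z))
      \<le> - ln (1 - \<mu> * (1 * norm z)) - - ln (1 - \<mu> * (0 * norm z))"
  proof (rule differentiable_bound_general[where f = "\<lambda>t. H (of_real t * z)"])
    have "continuous_on (ball 0 1) H"
      using H by (meson DERIV_isCont continuous_at_imp_continuous_on)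
    then show "continuous_on {0..1} (\<lambda>t. H (of_real t * z))"
      by (rule continuous_on_compose2) (use in_ball in \<open>auto intro!: continuous_intros\<close>)
    show "continuous_on {0..1} (\<lambda>t. - ln (1 - \<mu> * (t * norm z)))"
      using pos by (intro continuous_intros) fastforce
    fix t :: real assume t: "0 < t" "t < 1"
    let ?w = "of_real t * z"
    have wb: "?w \<in> ball 0 1 - {0}" using in_ball[of t] t False by auto
    show "((\<lambda>t. H (of_real t * z)) has_vector_derivative z * h ?w) (at t)"
    proof -
      have "((\<lambda>t. of_real t * z) has_vector_derivative z) (at t)"
        by (auto intro!: derivative_eq_intros simp: has_vector_derivative_def scaleR_conv_of_real)
      from field_vector_diff_chain_at[OF this H] wb show ?thesis by (simp add: o_def)
    qed
    show "((\<lambda>t. - ln (1 - \<mu> * (t * norm z))) has_vector_derivative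
        norm z * (\<mu> / (1 - \<mu> * (t * norm z)))) (at t)"
      unfolding has_real_derivative_iff_has_vector_derivative[symmetric]
      using pos[of t] t by (auto intro!: derivative_eq_intros)
    show "norm (z * h ?w) \<le> norm z * (\<mu> / (1 - \<mu> * (t * norm z)))"
      using bnd[OF wb] t unfolding norm_mult by (intro mult_left_mono) auto
  qed auto
  then have "norm (H z) \<le> - ln (1 - \<mu> * norm z)" by (simp add: H_def)
  then have "exp (norm (H z)) \<le> exp (- ln (1 - \<mu> * norm z))" by simp
  also have "\<dots> = 1 / (1 - \<mu> * norm z)" using pos[of 1] by (simp add: exp_minus field_simps)
  finally show ?thesis using norm_exp[of "H z"] unfolding \<open>u z = exp (H z)\<close>
    by (rule order_trans[rotated])
qed

section \<open>From the class condition to \<open>u = f' (1 + z W)\<close>\<close>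

text \<open>A finite limit at every point leaves only removable singularities, so
  \<open>remove_sings\<close> turns the meromorphic \<open>G_expr\<close> into a holomorphic
  function whose values are these limits.\<close>

lemma G_class_extension:
  assumes "f \<in> G_class lam \<alpha>"
  obtains g where "g holomorphic_on ball 0 1"
    "\<And>z. z \<in> ball 0 1 \<Longrightarrow> norm (g z) < lam"
    "\<And>z. z \<in> ball 0 1 \<Longrightarrow> (G_expr \<alpha> f \<longlongrightarrow> g z) (at z)"
proof -
  have holf: "f holomorphic_on ball 0 1"
    and lim: "\<And>z. z \<in> ball 0 1 \<Longrightarrow> \<exists>v. (G_expr \<alpha> f \<longlongrightarrow> v) (at z) \<and> norm v < lam"
    using assms by (auto simp: G_class_def class_A_def)
  let ?g = "remove_sings (G_expr \<alpha> f)"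
  have mf: "f meromorphic_on ball 0 1"
    using holf by (simp add: analytic_on_imp_meromorphic_on analytic_on_open)
  have mG: "G_expr \<alpha> f meromorphic_on ball 0 1"
    unfolding G_expr_def[abs_def] by (intro meromorphic_intros mf)
  have g: "(G_expr \<alpha> f \<longlongrightarrow> ?g z) (at z) \<and> norm (?g z) < lam \<and> ?g analytic_on {z}"
    if z: "z \<in> ball 0 1" for z
  proof -
    obtain v where v: "(G_expr \<alpha> f \<longlongrightarrow> v) (at z)" "norm v < lam" using lim[OF z] by blast
    have "isolated_singularity_at (G_expr \<alpha> f) z"
      by (rule meromorphic_on_isolated_singularity[OF meromorphic_on_subset[OF mG]]) (use z in auto)
    then have "?g analytic_on {z}" using v(1) by (rule remove_sings_analytic_at)
    then show ?thesis using v remove_sings_eqI[OF v(1)] by auto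
  qed
  have "?g analytic_on ball 0 1" using g analytic_on_analytic_at by blast
  then show ?thesis using that g analytic_imp_holomorphic by blast
qed

lemma deriv_id_times:
  fixes f u :: "complex \<Rightarrow> complex"
  assumes hol: "u holomorphic_on S" and S: "open S"
    and eq: "\<And>z. z \<in> S \<Longrightarrow> f z = z * u z" and z: "z \<in> S"
  shows "deriv f z = u z + z * deriv u z"
proof (rule DERIV_imp_deriv)
  have "((\<lambda>z. z * u z) has_field_derivative u z + z * deriv u z) (at z)"
    using holomorphic_derivI[OF hol S z] by (auto intro!: derivative_eq_intros)
  then show "(f has_field_derivative u z + z * deriv u z) (at z)"
    by (rule has_field_derivative_transform_within_open[OF _ S z]) (simp add: eq)
qed

text \<open>Put \<open>q = u / f'\<close>: the denominator in \<open>G_expr\<close> is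
  \<open>1 / q\<close>, and the last bracket is \<open>q'\<close> by the quotient rule. Since
  \<open>z * u' = f' - u\<close>, one has \<open>z q' = 1 - q - z u f'' / f'^2\<close>, which trades
  the second derivative for \<open>q'\<close>.\<close>

lemma G_expr_quotient:
  assumes "z \<noteq> 0" "u \<noteq> 0" "deriv f z \<noteq> 0" "f z = z * u" "deriv f z = u + z * u'"
  shows "G_expr \<alpha> f z = (1 - 2 * of_real \<alpha>) * (u / deriv f z - 1)
    - of_real \<alpha> * z * ((u' * deriv f z - u * deriv (deriv f) z) / (deriv f z)\<^sup>2)"
proof -
  have zu': "z * u' = deriv f z - u" using assms(5) by simp
  have "z * ((u' * deriv f z - u * deriv (deriv f) z) / (deriv f z)\<^sup>2)
      = (z * u' * deriv f z - z * u * deriv (deriv f) z) / (deriv f z)\<^sup>2"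
    by (simp add: algebra_simps)
  also have "\<dots> = 1 - u / deriv f z - z * u * deriv (deriv f) z / (deriv f z)\<^sup>2"
    unfolding zu' using assms(3) by (simp add: field_simps power2_eq_square)
  finally have *: "of_real \<alpha> * z * ((u' * deriv f z - u * deriv (deriv f) z) / (deriv f z)\<^sup>2)
      = of_real \<alpha> * (1 - u / deriv f z - z * u * deriv (deriv f) z / (deriv f z)\<^sup>2)"
    by (simp only: mult.assoc)
  show ?thesis
    unfolding * G_expr_def assms(4) using assms(1-3)
    by (simp add: field_simps power2_eq_square)
qed

text \<open>The last conclusion is a product, not a quotient, because zeros of
  \<open>deriv f\<close> are not excluded beforehand. In this form both sides are holomorphic on the
  whole disc, so the identity need only be verified near 0.\<close>

lemma G_class_representation:
  fixes lam \<alpha> :: real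
  assumes f: "f \<in> G_class lam \<alpha>"
    and a: "1 / 3 < \<alpha>" and lam: "0 < lam" "lam < 3 * \<alpha> - 1"
    and holu: "u holomorphic_on ball 0 1" and fu: "\<And>z. z \<in> ball 0 1 \<Longrightarrow> f z = z * u z"
    and u0: "u 0 = 1"
  obtains W where "W holomorphic_on ball 0 1"
    "\<And>z. z \<in> ball 0 1 - {0} \<Longrightarrow> norm (W z) \<le> lam / (3 * \<alpha> - 1)"
    "\<And>z. z \<in> ball 0 1 \<Longrightarrow> u z = deriv f z * (1 + z * W z)"
proof -
  have holf: "f holomorphic_on ball 0 1" and df0: "deriv f 0 = 1"
    using f by (auto simp: G_class_def class_A_def)
  have holdf: "deriv f holomorphic_on ball 0 1" using holf by (simp add: holomorphic_deriv)
  obtain g where holg: "g holomorphic_on ball 0 1"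
    and gb: "\<And>z. z \<in> ball 0 1 \<Longrightarrow> norm (g z) < lam"
    and gl: "\<And>z. z \<in> ball 0 1 \<Longrightarrow> (G_expr \<alpha> f \<longlongrightarrow> g z) (at z)"
    using G_class_extension[OF f] by blast
  have dfu: "deriv f z = u z + z * deriv u z" if "z \<in> ball 0 1" for z
    using deriv_id_times[OF holu open_ball _ that] fu by simp
  \<comment> \<open>Both \<open>u\<close> and \<open>deriv f\<close> equal 1 at 0, so their quotient
    is regular on a small ball. All work with \<open>q\<close> stays inside it.\<close>
  obtain r where r: "0 < r" "r \<le> 1" and nz: "\<And>z. z \<in> ball 0 r \<Longrightarrow> u z \<noteq> 0 \<and> deriv f z \<noteq> 0"
  proof -
    have cont: "isCont u 0" "isCont (deriv f) 0"
      using holu holdf holomorphic_on_imp_continuous_on continuous_on_interior[of "ball 0 1"]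
      by (metis centre_in_ball interior_ball zero_less_one)+
    have "eventually (\<lambda>z. u z \<noteq> 0) (nhds 0)" "eventually (\<lambda>z. deriv f z \<noteq> 0) (nhds 0)"
      using tendsto_imp_eventually_ne[of u "u 0" "nhds 0" 0]
        tendsto_imp_eventually_ne[of "deriv f" "deriv f 0" "nhds 0" 0] cont u0 df0
      unfolding isCont_def tendsto_at_iff_tendsto_nhds by auto
    then have "eventually (\<lambda>z. u z \<noteq> 0 \<and> deriv f z \<noteq> 0) (nhds 0)" by (rule eventually_conj)
    then obtain d where "d > 0" "\<And>z. dist z 0 < d \<Longrightarrow> u z \<noteq> 0 \<and> deriv f z \<noteq> 0"
      unfolding eventually_nhds_metric by blast
    then show ?thesis by (intro that[of "min d 1"]) (auto simp: dist_commute)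
  qed
  have sub: "z \<in> ball 0 1" if "z \<in> ball 0 r" for z :: complex using that r by auto
  define q where "q z = u z / deriv f z" for z
  have q0: "q 0 = 1" by (simp add: q_def u0 df0)
  have holq: "q holomorphic_on ball 0 r" unfolding q_def
    using nz sub by (intro holomorphic_intros holomorphic_on_subset[OF holu]
        holomorphic_on_subset[OF holdf]) auto
  have dq: "deriv q z = (deriv u z * deriv f z - u z * deriv (deriv f) z) / (deriv f z)\<^sup>2"
    if z: "z \<in> ball 0 r" for z
    unfolding q_def power2_eq_square
    by (rule DERIV_imp_deriv, rule DERIV_divide)
      (use z nz sub in \<open>auto intro!: holomorphic_derivI[OF holu] holomorphic_derivI[OF holdf]\<close>)
  define rhs where "rhs z = (1 - 2 * of_real \<alpha>) * (q z - 1) - of_real \<alpha> * z * deriv q z" for z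
  have holrhs: "rhs holomorphic_on ball 0 r"
    unfolding rhs_def using holq by (intro holomorphic_intros) auto
  \<comment> \<open>The origin is left out because the formula divides by zero there.\<close>
  have Grhs: "G_expr \<alpha> f z = rhs z" if z: "z \<in> ball 0 r - {0}" for z
    unfolding rhs_def q_def using z nz[of z] sub[of z] fu[of z] dfu[of z] dq[of z]
    by (subst G_expr_quotient[where u = "u z" and u' = "deriv u z"]) (auto simp: q_def[abs_def])
  \<comment> \<open>Comparing limits instead of values carries the equation over to 0, where it
    yields \<open>g 0 = 0\<close>, the hypothesis of the Schwarz lemma.\<close>
  have grhs: "g z = rhs z" if z: "z \<in> ball 0 r" for z
  proof (rule tendsto_unique[OF _ gl[OF sub[OF z]]])
    have "isCont rhs z" using holrhs z
      by (metis continuous_on_interior holomorphic_on_imp_continuous_on interior_ball)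
    then have "(rhs \<longlongrightarrow> rhs z) (at z)" by (simp add: isCont_def)
    moreover have "eventually (\<lambda>w. w \<in> ball 0 r - {0}) (at z)"
    proof (cases "z = 0")
      case True
      then show ?thesis using r eventually_at_in_open[of "ball 0 r" "0::complex"] by simp
    next
      case False
      then have "eventually (\<lambda>w. w \<in> ball 0 r - {0}) (nhds z)"
        using z by (intro eventually_nhds_in_open) auto
      then show ?thesis by (rule eventually_nhds_conv_at[THEN iffD1, THEN conjunct1])
    qed
    then have "eventually (\<lambda>w. rhs w = G_expr \<alpha> f w) (at z)"
      by eventually_elim (use Grhs in simp)
    ultimately show "(G_expr \<alpha> f \<longlongrightarrow> rhs z) (at z)" by (rule Lim_transform_eventually)
  qed auto
  have g0: "g 0 = 0" using grhs[of 0] r q0 by (simp add: rhs_def)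
  obtain k where holk: "k holomorphic_on ball 0 1"
    and gk: "\<And>z. norm z < 1 \<Longrightarrow> g z = z * k z"
    using Schwarz3[OF holg g0] by blast
  have kb: "norm (k z) \<le> lam" if z: "z \<in> ball 0 1 - {0}" for z
  proof -
    have "norm (g z / of_real lam) \<le> norm z"
    proof (rule Schwarz_Lemma(1))
      show "(\<lambda>z. g z / of_real lam) holomorphic_on ball 0 1"
        using lam by (intro holomorphic_intros holg) auto
    qed (use g0 gb lam z in \<open>auto simp: norm_divide\<close>)
    then have "norm z * norm (k z) \<le> norm z * lam"
      using z gk[of z] lam by (simp add: norm_mult norm_divide field_simps)
    then show ?thesis using z by simp
  qed
  have b: "0 < 3 * \<alpha> - 1" using a by simp
  \<comment> \<open>A solution on the whole disc, independent of any poles of \<open>q\<close>; the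
    condition \<open>1 / 3 < \<alpha>\<close> makes the coefficient \<open>3 * \<alpha> - 1\<close>
    positive.\<close>
  obtain W where holW: "W holomorphic_on ball 0 1"
    and W: "\<And>z. z \<in> ball 0 1 \<Longrightarrow>
      of_real \<alpha> * z * deriv W z + of_real (3 * \<alpha> - 1) * W z = - k z"
    by (rule radial_ode_solution[of "\<lambda>z. - k z" \<alpha> "3 * \<alpha> - 1"])
      (use holk a in \<open>auto intro!: holomorphic_intros\<close>)
  obtain V where holV: "V holomorphic_on ball 0 r"
    and qV: "\<And>z. norm z < r \<Longrightarrow> q z - 1 = z * V z"
    by (rule Schwarz3[of "\<lambda>z. q z - 1" r]) (use holq q0 in \<open>auto intro!: holomorphic_intros\<close>)
  have V: "of_real \<alpha> * z * deriv V z + of_real (3 * \<alpha> - 1) * V z = - k z"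
    if z: "z \<in> ball 0 r - {0}" for z
  proof -
    have zr: "z \<in> ball 0 r" using z by simp
    have "deriv (\<lambda>z. q z - 1) z = V z + z * deriv V z"
      using deriv_id_times[OF holV open_ball _ zr] qV by simp
    moreover have "deriv (\<lambda>z. q z - 1) z = deriv q z"
      using holomorphic_on_imp_differentiable_at[OF holq open_ball zr] by (simp add: deriv_diff)
    ultimately have dqV: "deriv q z = V z + z * deriv V z" by simp
    \<comment> \<open>Collecting the terms in \<open>V\<close> gives the coefficient
      \<open>\<alpha> - (1 - 2 * \<alpha>) = 3 * \<alpha> - 1\<close>.\<close>
    have "z * k z = (1 - 2 * of_real \<alpha>) * (z * V z) - of_real \<alpha> * z * (V z + z * deriv V z)"
      using grhs[of z] gk[of z] qV[of z] z sub[of z] dqV by (simp add: rhs_def)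
    then have "z * (of_real \<alpha> * z * deriv V z + of_real (3 * \<alpha> - 1) * V z) = z * (- k z)"
      by (simp add: algebra_simps)
    moreover have "z \<noteq> 0" using z by simp
    ultimately show ?thesis by (metis mult_left_cancel)
  qed
  \<comment> \<open>Uniqueness: the difference of the two solutions satisfies the homogeneous
    equation, so the radial bound applies with \<open>M = 0\<close>.\<close>
  have VW: "V z = W z" if z: "z \<in> ball 0 r - {0}" for z
  proof -
    have holWr: "W holomorphic_on ball 0 r" using holW sub by (auto intro: holomorphic_on_subset)
    have "norm (V z - W z) \<le> 0 / (3 * \<alpha> - 1)"
    proof (rule radial_ode_bound[of "\<lambda>z. V z - W z" r \<alpha>])
      fix w :: complex assume w: "w \<in> ball 0 r - {0}"
      have dD: "deriv (\<lambda>z. V z - W z) w = deriv V w - deriv W w"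
        using w holV holWr by (intro deriv_diff) (auto simp: holomorphic_on_imp_differentiable_at)
      have "of_real \<alpha> * w * deriv (\<lambda>z. V z - W z) w + of_real (3 * \<alpha> - 1) * (V w - W w)
          = (of_real \<alpha> * w * deriv V w + of_real (3 * \<alpha> - 1) * V w)
            - (of_real \<alpha> * w * deriv W w + of_real (3 * \<alpha> - 1) * W w)"
        unfolding dD by (simp add: algebra_simps)
      also have "\<dots> = 0" using V[OF w] W[of w] w sub[of w] by simp
      finally show "norm (of_real \<alpha> * w * deriv (\<lambda>z. V z - W z) w
          + of_real (3 * \<alpha> - 1) * (V w - W w)) \<le> 0" by simp
    qed (use holV holWr z a in \<open>auto intro!: holomorphic_intros\<close>)
    then show ?thesis by simp
  qed
  show ?thesis
  proof (rule that[OF holW])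
    fix z :: complex assume z: "z \<in> ball 0 1 - {0}"
    show "norm (W z) \<le> lam / (3 * \<alpha> - 1)"
      by (rule radial_ode_bound[OF holW _ b _ z, of \<alpha>]) (use W kb a in auto)
  next
    fix z :: complex assume z: "z \<in> ball 0 1"
    show "u z = deriv f z * (1 + z * W z)"
    proof (rule analytic_continuation_open[of "ball 0 r" "ball 0 1" u])
      fix w :: complex assume w: "w \<in> ball 0 r"
      show "u w = deriv f w * (1 + w * W w)"
      proof (cases "w = 0")
        case True
        then show ?thesis by (simp add: u0 df0)
      next
        case False
        then have "q w - 1 = w * W w" using qV[of w] VW[of w] w by simp
        then show ?thesis using nz[OF w] by (simp add: q_def field_simps)
      qed
    qed (use r z sub holu holdf holW in \<open>auto intro!: holomorphic_intros\<close>)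
  qed
qed

section \<open>The final estimate\<close>

theorem theorem2p9:
  fixes lam \<alpha> :: real
  assumes "lam > 0"
    and "1 / 3 < \<alpha>" and "\<alpha> < 1"
    and "lam < (2 - sqrt 3) * (3 * \<alpha> - 1)"
  shows "G_class lam \<alpha> \<subseteq> Omega_class"
proof
  fix f assume f: "f \<in> G_class lam \<alpha>"
  define \<mu> where "\<mu> = lam / (3 * \<alpha> - 1)"
  have \<mu>: "0 < \<mu>" "\<mu> < 2 - sqrt 3"
    using assms by (auto simp: \<mu>_def field_simps)
  \<comment> \<open>This puts \<open>\<mu>\<close> below 1, which keeps \<open>1 + z * W z\<close>
    away from zero on the disc.\<close>
  have "1 < sqrt 3" by simp
  then have \<mu>1: "\<mu> < 1" using \<mu> by linarith
  have lam1: "lam < 3 * \<alpha> - 1" using \<mu>1 assms(2) by (simp add: \<mu>_def field_simps)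
  have fA: "f \<in> class_A" using f by (simp add: G_class_def)
  then have holf: "f holomorphic_on ball 0 1" and f0: "f 0 = 0" and df0: "deriv f 0 = 1"
    by (auto simp: class_A_def)
  obtain u where holu: "u holomorphic_on ball 0 1" and fu: "\<And>z. norm z < 1 \<Longrightarrow> f z = z * u z"
    and u0: "u 0 = 1"
    using Schwarz3[OF holf f0] df0 by metis
  have dfu: "deriv f z = u z + z * deriv u z" if "z \<in> ball 0 1" for z
    using deriv_id_times[OF holu open_ball _ that] fu by simp
  obtain W where holW: "W holomorphic_on ball 0 1"
    and Wb: "\<And>z. z \<in> ball 0 1 - {0} \<Longrightarrow> norm (W z) \<le> \<mu>"
    and uW: "\<And>z. z \<in> ball 0 1 \<Longrightarrow> u z = deriv f z * (1 + z * W z)"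
    using G_class_representation[OF f assms(2,1) lam1 holu _ u0] fu unfolding \<mu>_def by auto
  have zW: "norm (z * W z) \<le> \<mu> * norm z" "\<mu> * norm z < 1" if z: "z \<in> ball 0 1" for z
  proof -
    show "norm (z * W z) \<le> \<mu> * norm z"
      using Wb[of z] z by (cases "z = 0") (auto simp: norm_mult mult.commute mult_right_mono)
    have "\<mu> * norm z \<le> \<mu> * 1" using z \<mu> by (intro mult_left_mono) auto
    then show "\<mu> * norm z < 1" using \<mu>1 by simp
  qed
  have den: "1 - \<mu> * norm z \<le> norm (1 + z * W z)" "1 + z * W z \<noteq> 0" if z: "z \<in> ball 0 1" for z
  proof -
    have "1 - norm (z * W z) \<le> norm (1 + z * W z)"
      using norm_diff_ineq[of 1 "z * W z"] by simp
    then show "1 - \<mu> * norm z \<le> norm (1 + z * W z)" using zW[OF z] by linarith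
    then show "1 + z * W z \<noteq> 0" using zW(2)[OF z] by auto
  qed
  \<comment> \<open>The logarithmic derivative of \<open>u\<close>, written through \<open>W\<close>
    so that zeros of \<open>u\<close> cannot produce poles.\<close>
  define h where "h z = - W z / (1 + z * W z)" for z
  have holh: "h holomorphic_on ball 0 1"
    unfolding h_def using den by (intro holomorphic_intros holW) auto
  have hb: "norm (h z) \<le> \<mu> / (1 - \<mu> * norm z)" if z: "z \<in> ball 0 1 - {0}" for z
    unfolding h_def norm_divide norm_minus_cancel
    using Wb[OF z] den(1)[of z] zW(2)[of z] z \<mu> by (intro frac_le) auto
  have du: "deriv u z = h z * u z" if z: "z \<in> ball 0 1" for z
  \<comment> \<open>Substituting \<open>f' = u + w u'\<close> into \<open>u = f' (1 + w W)\<close>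
    leaves a common factor \<open>w\<close>; cancelling it gives the claim off 0, and continuation
    adds the origin.\<close>
  proof (rule analytic_continuation_open[of "ball 0 1 - {0}" "ball 0 1" "deriv u"])
    fix w :: complex assume w: "w \<in> ball 0 1 - {0}"
    have "u w = (u w + w * deriv u w) * (1 + w * W w)"
      using uW[of w] dfu[of w] w by simp
    then have "w * (deriv u w * (1 + w * W w)) = w * (- W w * u w)"
      by algebra
    moreover have "w \<noteq> 0" using w by simp
    ultimately have "deriv u w * (1 + w * W w) = - W w * u w" by (metis mult_left_cancel)
    then show "deriv u w = h w * u w"
      using den(2)[of w] w by (simp add: h_def field_simps)
  next
    show "ball (0::complex) 1 - {0} \<noteq> {}"
      by (auto intro!: exI[of _ "1/2"] simp: set_eq_iff)
  qed (use z holu holh in \<open>auto intro!: holomorphic_intros\<close>)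
  have ub: "norm (u z) \<le> 1 / (1 - \<mu> * norm z)" if z: "z \<in> ball 0 1" for z
  proof (rule log_derivative_growth[where u = u and h = h])
    fix w :: complex assume w: "w \<in> ball 0 1"
    show "(u has_field_derivative h w * u w) (at w)"
      using holomorphic_derivI[OF holu open_ball w] du[OF w] by simp
  qed (use \<mu> \<mu>1 hb z holh u0 in auto)
  have "norm (z * deriv f z - f z) < 1 / 2" if z: "z \<in> ball 0 1" for z
  proof (cases "z = 0")
    case True
    then show ?thesis by (simp add: f0)
  next
    case False
    let ?r = "norm z"
    have r: "0 < ?r" "?r < 1" using z False by auto
    have "z * deriv f z - f z = z\<^sup>2 * (h z * u z)"
      using fu[of z] dfu[OF z] du[OF z] z by (simp add: algebra_simps power2_eq_square)
    then have "norm (z * deriv f z - f z) = ?r\<^sup>2 * (norm (h z) * norm (u z))"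
      by (simp add: norm_mult norm_power)
    also have "\<dots> \<le> ?r\<^sup>2 * (\<mu> / (1 - \<mu> * ?r) * (1 / (1 - \<mu> * ?r)))"
      using hb[of z] ub[OF z] z False zW(2)[OF z] \<mu> by (intro mult_left_mono mult_mono) auto
    also have "\<dots> < 1 / 2"
    proof -
      \<comment> \<open>The origin of the constant: \<open>2 - sqrt 3\<close> is the smaller root of
        \<open>x^2 - 4 x + 1\<close>, and \<open>2 * \<mu> < (1 - \<mu>)^2\<close> is the same as
        \<open>3 < (2 - \<mu>)^2\<close>.\<close>
      have "sqrt 3 < 2 - \<mu>" using \<mu> by simp
      then have "(sqrt 3)\<^sup>2 < (2 - \<mu>)\<^sup>2" by (intro power_strict_mono) auto
      then have key: "2 * \<mu> < (1 - \<mu>)\<^sup>2" by (simp add: power2_eq_square algebra_simps)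
      \<comment> \<open>The bound increases with \<open>?r\<close>, so it is compared with its value
        at radius 1.\<close>
      have "?r\<^sup>2 \<le> 1" using r by (simp add: power_le_one)
      then have "2 * (?r\<^sup>2 * \<mu>) \<le> 2 * \<mu>" using \<mu> by (simp add: mult_left_le_one_le)
      also have "\<dots> < (1 - \<mu>)\<^sup>2" by (rule key)
      also have "\<dots> \<le> (1 - \<mu> * ?r)\<^sup>2" using r \<mu> \<mu>1 by (intro power_mono) (auto simp: mult_left_le)
      finally have "?r\<^sup>2 * \<mu> / (1 - \<mu> * ?r)\<^sup>2 < 1 / 2"
        using zW(2)[OF z] by (simp add: divide_less_eq)
      then show ?thesis by (simp add: power2_eq_square)
    qed
    finally show ?thesis .
  qed
  then show "f \<in> Omega_class" using fA by (simp add: Omega_class_def)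
qed

end
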